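(* If $G$ is a graph of order $n$, then $$c(G)+\overline c(G)\geq n+d(G)+\overline d(G)-1\geq n+1.$$
   Context: Graphs are finite and simple with nonempty vertex set; the order is the number of vertices. A clique is a set of pairwise adjacent vertices, an anticlique is a set of pairwise non-adjacent vertices (sets with at most one vertex are both); maximal means maximal with respect to inclusion. $c(G)$ is the number of maximal cliques and $\overline c(G)$ the number of maximal anticliques of $G$. For a vertex $v$, $D(v)$ is the number of maximal cliques containing $v$ and $\overline D(v)$ is the number of maximal anticliques containing $v$; $d(G)=\min\{D(v):v\in V(G)\}$ and $\overline d(G)=\min\{\overline D(v):v\in V(G)\}$. *)

theory Defs
  imports "HOL-Library.Ramsey"
begin

text \<open>
  A simple graph is given by its vertex set \<open>V\<close> and its edge set \<open>E \<subseteq> [V]\<^bsup>2\<^esup>\<close> of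
  two-element vertex sets. The predicates \<open>clique\<close> and \<open>indep\<close> do not mention \<open>V\<close>,
  so the restriction to subsets of \<open>V\<close> is explicit below.
\<close>

definition max_cliques :: "'a set \<Rightarrow> 'a set set \<Rightarrow> 'a set set" where
  "max_cliques V E =
    {K. K \<subseteq> V \<and> clique K E \<and> (\<forall>K'. K' \<subseteq> V \<and> clique K' E \<and> K \<subseteq> K' \<longrightarrow> K' = K)}"

definition max_anticliques :: "'a set \<Rightarrow> 'a set set \<Rightarrow> 'a set set" where
  "max_anticliques V E =
    {A. A \<subseteq> V \<and> indep A E \<and> (\<forall>A'. A' \<subseteq> V \<and> indep A' E \<and> A \<subseteq> A' \<longrightarrow> A' = A)}"

definition num_max_cliques :: "'a set \<Rightarrow> 'a set set \<Rightarrow> nat" where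
  "num_max_cliques V E = card (max_cliques V E)"

definition num_max_anticliques :: "'a set \<Rightarrow> 'a set set \<Rightarrow> nat" where
  "num_max_anticliques V E = card (max_anticliques V E)"

definition clique_deg :: "'a set \<Rightarrow> 'a set set \<Rightarrow> 'a \<Rightarrow> nat" where
  "clique_deg V E v = card {K \<in> max_cliques V E. v \<in> K}"

definition anticlique_deg :: "'a set \<Rightarrow> 'a set set \<Rightarrow> 'a \<Rightarrow> nat" where
  "anticlique_deg V E v = card {A \<in> max_anticliques V E. v \<in> A}"

definition min_clique_deg :: "'a set \<Rightarrow> 'a set set \<Rightarrow> nat" where
  "min_clique_deg V E = Min (clique_deg V E ` V)"

definition min_anticlique_deg :: "'a set \<Rightarrow> 'a set set \<Rightarrow> nat" where
  "min_anticlique_deg V E = Min (anticlique_deg V E ` V)"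

end

theory Submission
  imports Defs
begin

text \<open>
  The proof is an induction that splits the graph at a vertex \<open>v\<close> into its neighbourhood \<open>N\<close> and its
  non-neighbourhood \<open>M\<close>. The maximal cliques of \<open>N\<close> correspond to the maximal cliques
  containing \<open>v\<close>, and distinct maximal anticliques of \<open>N\<close> extend to distinct maximal anticliques
  of the graph, which avoid \<open>v\<close> because they meet \<open>N\<close>. Hence the bound for
  \<open>N\<close> is a lower bound for \<open>D(v) + (\<^bold>c - \<^bold>D(v))\<close>, bold letters standing for the
  anticlique counts, and the bound for \<open>M\<close> is one for \<open>\<^bold>D(v) + (c - D(v))\<close>. In the sum of the
  two the degrees of \<open>v\<close> cancel and \<open>c + \<^bold>c\<close> remains.

  For this to work with the terms \<open>d\<close> and \<open>\<^bold>d\<close>, the induction must not replace them by the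
  minimum degrees of the subgraphs. The claim is therefore proved for a vertex set \<open>S\<close>
  and arbitrary finite families of sets that trace cliques, or anticliques, on \<open>S\<close>,
  cover every clique, or anticlique, of \<open>S\<close>, and contain each vertex of \<open>S\<close> at least
  \<open>d\<close>, or \<open>\<^bold>d\<close>, times (\<open>cover_bound\<close>). On \<open>N\<close> the family of cliques is cut down to the
  members containing \<open>v\<close>, which still contain each vertex of \<open>N\<close> at least once
  (\<open>clique_cover_link\<close>), while the family of anticliques is kept and with it the full
  value \<open>\<^bold>d\<close>. So the two bounds are

  \<open>D(v) + (\<^bold>c - \<^bold>D(v)) \<ge> |N| - 1 + 1 + \<^bold>d\<close> and
  \<open>\<^bold>D(v) + (c - D(v)) \<ge> |M| - 1 + d + 1\<close>,

  and because \<open>|N| + |M| = |S| - 1\<close> their sum is the claim for \<open>S\<close>. When \<open>v\<close> has no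
  neighbour in \<open>S\<close>, or is adjacent to every other vertex of it, it is simply deleted: in the first
  case, for example, the cliques through \<open>v\<close> meet \<open>S\<close> in \<open>v\<close> alone and are lost, and as
  there is at least one of them this pays for the lost vertex.
\<close>

section \<open>Families covering the cliques of a vertex set\<close>

text \<open>
  The members may extend beyond \<open>S\<close>: replacing them by their traces on \<open>S\<close> could identify some of
  them and so lower the degrees. Anticliques are the cliques of the complementary edge set \<open>- E\<close>,
  so that one notion serves both kinds.
\<close>

definition clique_cover :: "'a set \<Rightarrow> 'a set set \<Rightarrow> 'a set set \<Rightarrow> nat \<Rightarrow> bool" where
  "clique_cover S E F d \<longleftrightarrow>
     finite F \<and>
     (\<forall>K\<in>F. clique (K \<inter> S) E) \<and>
     (\<forall>C\<subseteq>S. clique C E \<longrightarrow> (\<exists>K\<in>F. C \<subseteq> K)) \<and>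
     (\<forall>u\<in>S. d \<le> card {K \<in> F. u \<in> K})"

definition meeting :: "'a set set \<Rightarrow> 'a set \<Rightarrow> 'a set set" where
  "meeting F S = {K \<in> F. K \<inter> S \<noteq> {}}"

lemma indep_iff_clique_complement: "indep A E \<longleftrightarrow> clique A (- E)"
  by (simp add: indep_def clique_def)

lemma clique_insert:
  assumes "clique C E" and "\<And>u. u \<in> C \<Longrightarrow> u \<noteq> v \<Longrightarrow> {v, u} \<in> E"
  shows "clique (insert v C) E"
  using assms unfolding clique_def by (auto simp: insert_commute)

lemma clique_coverI:
  assumes "finite F" and "\<And>K. K \<in> F \<Longrightarrow> clique (K \<inter> S) E"
    and "\<And>C. C \<subseteq> S \<Longrightarrow> clique C E \<Longrightarrow> \<exists>K\<in>F. C \<subseteq> K"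
    and "\<And>u. u \<in> S \<Longrightarrow> d \<le> card {K \<in> F. u \<in> K}"
  shows "clique_cover S E F d"
  using assms by (simp add: clique_cover_def)

lemma clique_coverD:
  assumes "clique_cover S E F d"
  shows "finite F" and "\<And>K. K \<in> F \<Longrightarrow> clique (K \<inter> S) E"
    and "\<And>C. C \<subseteq> S \<Longrightarrow> clique C E \<Longrightarrow> \<exists>K\<in>F. C \<subseteq> K"
    and "\<And>u. u \<in> S \<Longrightarrow> d \<le> card {K \<in> F. u \<in> K}"
  using assms by (simp_all add: clique_cover_def)

lemma clique_subset:
  assumes "clique K E" and "C \<subseteq> K"
  shows "clique C E"
  using assms unfolding clique_def by blast

lemma clique_cover_subset:
  assumes "clique_cover S E F d" and "T \<subseteq> S"
  shows "clique_cover T E F d"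
proof (rule clique_coverI)
  show "clique (K \<inter> T) E" if "K \<in> F" for K
    using clique_coverD(2)[OF assms(1) that] assms(2) by (rule_tac clique_subset) auto
  show "\<exists>K\<in>F. C \<subseteq> K" if "C \<subseteq> T" "clique C E" for C
    using that assms(2) by (intro clique_coverD(3)[OF assms(1)]) auto
qed (use clique_coverD[OF assms(1)] assms(2) in auto)

lemma clique_cover_degree_pos:
  assumes "clique_cover S E F d" and "v \<in> S"
  shows "1 \<le> card {K \<in> F. v \<in> K}"
proof -
  have "clique {v} E" by (simp add: clique_def)
  then obtain K where "K \<in> F" "v \<in> K"
    using clique_coverD(3)[OF assms(1), of "{v}"] assms(2) by auto
  then show ?thesis
    using clique_coverD(1)[OF assms(1)] by (auto simp: Suc_le_eq card_gt_0_iff)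
qed

text \<open>
  A clique \<open>C\<close> of common neighbours of \<open>v\<close> extends to the clique \<open>C \<union> {v}\<close>, so it
  lies in a member through \<open>v\<close>. Only degree one survives: few members need contain
  both \<open>v\<close> and a given neighbour.
\<close>

lemma clique_cover_link:
  assumes cov: "clique_cover S E F d" and v: "v \<in> S"
    and T: "T \<subseteq> S" and adj: "\<And>u. u \<in> T \<Longrightarrow> {v, u} \<in> E"
  shows "clique_cover T E {K \<in> F. v \<in> K} 1"
proof -
  have cover: "\<exists>K\<in>{K \<in> F. v \<in> K}. C \<subseteq> K" if "C \<subseteq> T" "clique C E" for C
  proof -
    have "clique (insert v C) E" using that adj by (intro clique_insert) auto
    moreover have "insert v C \<subseteq> S" using that v T by blast
    ultimately obtain K where "K \<in> F" "insert v C \<subseteq> K"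
      using clique_coverD(3)[OF cov] by blast
    then show ?thesis by blast
  qed
  have fin: "finite {K \<in> F. v \<in> K}" using clique_coverD(1)[OF cov] by simp
  show ?thesis
  proof (rule clique_coverI[OF fin _ cover])
    show "clique (K \<inter> T) E" if "K \<in> {K \<in> F. v \<in> K}" for K
      using clique_coverD(2)[OF clique_cover_subset[OF cov T]] that by simp
    show "1 \<le> card {K \<in> {K \<in> F. v \<in> K}. u \<in> K}" if u: "u \<in> T" for u
    proof -
      have "clique {u} E" by (simp add: clique_def)
      then have "\<exists>K\<in>{K \<in> F. v \<in> K}. {u} \<subseteq> K" using u by (intro cover) simp_all
      then have "{K \<in> {K \<in> F. v \<in> K}. u \<in> K} \<noteq> {}" by blast
      moreover have "finite {K \<in> {K \<in> F. v \<in> K}. u \<in> K}"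
        using fin by (rule rev_finite_subset) blast
      ultimately show ?thesis by (metis One_nat_def Suc_leI card_gt_0_iff)
    qed
  qed
qed

text \<open>
  A member through \<open>v\<close> cannot meet a set of non-neighbours of \<open>v\<close>, so the members through
  \<open>v\<close> and those meeting such a set are counted separately.
\<close>

lemma clique_cover_separate:
  assumes cov: "clique_cover S E F d" and v: "v \<in> S"
    and T: "T \<subseteq> S - {v}" and nonadj: "\<And>u. u \<in> T \<Longrightarrow> {v, u} \<notin> E"
  shows "card (meeting F T) + card {K \<in> F. v \<in> K} \<le> card (meeting F S)"
proof -
  have fin: "finite F" by (rule clique_coverD(1)[OF cov])
  have "u \<notin> K" if "K \<in> F" "v \<in> K" "u \<in> T" for K u
  proof
    assume "u \<in> K"
    then have "v \<in> K \<inter> S" "u \<in> K \<inter> S" "v \<noteq> u" using that v T by auto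
    then have "{v, u} \<in> E"
      using clique_coverD(2)[OF cov that(1)] unfolding clique_def by blast
    then show False using nonadj[OF that(3)] by blast
  qed
  then have "meeting F T \<inter> {K \<in> F. v \<in> K} = {}" unfolding meeting_def by blast
  then have "card (meeting F T) + card {K \<in> F. v \<in> K}
      = card (meeting F T \<union> {K \<in> F. v \<in> K})"
    using fin by (subst card_Un_disjoint) (auto simp: meeting_def)
  also have "\<dots> \<le> card (meeting F S)"
    using fin v T by (intro card_mono) (auto simp: meeting_def)
  finally show ?thesis .
qed

section \<open>The bound for covering families\<close>

text \<open>
  The members of \<open>F\<close> through an isolated vertex \<open>v\<close> stop meeting the vertex set when \<open>v\<close> is deleted.
  At least one exists, since \<open>{v}\<close> is covered, so the bound drops by no more than the count does.
\<close>

lemma cover_bound_add_isolated: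
  assumes covF: "clique_cover S E F d" and finA: "finite A"
    and v: "v \<in> S" and finS: "finite S" and nonadj: "\<And>u. u \<in> S - {v} \<Longrightarrow> {v, u} \<notin> E"
    and bound: "card (S - {v}) + d + d' \<le>
                  card (meeting F (S - {v})) + card (meeting A (S - {v})) + 1"
  shows "card S + d + d' \<le> card (meeting F S) + card (meeting A S) + 1"
proof -
  have "card (meeting F (S - {v})) + card {K \<in> F. v \<in> K} \<le> card (meeting F S)"
    using clique_cover_separate[OF covF v subset_refl nonadj] .
  moreover have "1 \<le> card {K \<in> F. v \<in> K}"
    using clique_cover_degree_pos[OF covF v] .
  moreover have "card (meeting A (S - {v})) \<le> card (meeting A S)"
    using finA by (intro card_mono) (auto simp: meeting_def)
  moreover have "card S = card (S - {v}) + 1"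
    using finS v by (metis Suc_eq_plus1 card_Suc_Diff1)
  ultimately show ?thesis using bound by linarith
qed

text \<open>
  In the main case the induction hypothesis is used on the neighbours \<open>N\<close> of \<open>v\<close> with the
  cliques through \<open>v\<close> and all anticliques, and on the non-neighbours \<open>M\<close> with all cliques and the
  anticliques through \<open>v\<close>.
\<close>

lemma cover_bound:
  assumes "finite S" and "S \<noteq> {}"
    and "clique_cover S E F d" and "clique_cover S (- E) A d'"
  shows "card S + d + d' \<le> card (meeting F S) + card (meeting A S) + 1"
  using assms
proof (induction S arbitrary: F A d d' rule: finite_psubset_induct)
  case (psubset S)
  note covF = psubset.prems(2) and covA = psubset.prems(3)
  have finF: "finite F" and finA: "finite A"
    by (rule clique_coverD(1)[OF covF], rule clique_coverD(1)[OF covA])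
  obtain v where v: "v \<in> S" using psubset.prems(1) by blast
  define N where "N = {u \<in> S - {v}. {v, u} \<in> E}"
  define M where "M = {u \<in> S - {v}. {v, u} \<notin> E}"
  have S: "S - {v} = N \<union> M" "N \<inter> M = {}" by (auto simp: N_def M_def)
  have NM: "N \<subset> S" "M \<subset> S" "finite N" "finite M"
    using v psubset.hyps by (auto simp: N_def M_def)
  have card_S: "card S = card N + card M + 1"
    using psubset.hyps v S NM by (metis Suc_eq_plus1 card_Suc_Diff1 card_Un_disjoint)
  have sub: "clique_cover N E F d" "clique_cover N (- E) A d'"
    "clique_cover M E F d" "clique_cover M (- E) A d'"
    using clique_cover_subset[OF covF] clique_cover_subset[OF covA] NM by auto
  consider "S = {v}" | "N = {}" "M \<noteq> {}" | "M = {}" "N \<noteq> {}" | "N \<noteq> {}" "M \<noteq> {}"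
    using S v by blast
  then show ?case
  proof cases
    case 1
    have "meeting H S = {K \<in> H. v \<in> K}" for H :: "'a set set"
      using 1 by (auto simp: meeting_def)
    moreover have "d \<le> card {K \<in> F. v \<in> K}" "d' \<le> card {K \<in> A. v \<in> K}"
      by (rule clique_coverD(4)[OF covF v], rule clique_coverD(4)[OF covA v])
    ultimately show ?thesis using 1 by simp
  next
    case 2
    have M: "M = S - {v}" using 2 S by blast
    have "card M + d + d' \<le> card (meeting F M) + card (meeting A M) + 1"
      using psubset.IH[OF NM(2) 2(2) sub(3,4)] .
    then show ?thesis
      using M by (intro cover_bound_add_isolated[OF covF finA v psubset.hyps(1)]) (auto simp: M_def)
  next
    case 3
    have N: "N = S - {v}" using 3 S by blast
    have "card N + d + d' \<le> card (meeting F N) + card (meeting A N) + 1"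
      using psubset.IH[OF NM(1) 3(2) sub(1,2)] .
    \<comment> \<open>Now \<open>v\<close> is isolated in the complementary graph, where the two families swap roles.\<close>
    then have "card S + d' + d \<le> card (meeting A S) + card (meeting F S) + 1"
      using N by (intro cover_bound_add_isolated[OF covA finF v psubset.hyps(1)]) (auto simp: N_def)
    then show ?thesis by simp
  next
    case 4
    let ?Fv = "{K \<in> F. v \<in> K}" and ?Av = "{K \<in> A. v \<in> K}"
    have "clique_cover N E ?Fv 1"
      using NM by (intro clique_cover_link[OF covF v]) (auto simp: N_def)
    then have boundN: "card N + 1 + d' \<le> card (meeting ?Fv N) + card (meeting A N) + 1"
      using psubset.IH[OF NM(1) 4(1) _ sub(2)] by blast
    have "clique_cover M (- E) ?Av 1"
      using NM by (intro clique_cover_link[OF covA v]) (auto simp: M_def)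
    then have boundM: "card M + d + 1 \<le> card (meeting F M) + card (meeting ?Av M) + 1"
      using psubset.IH[OF NM(2) 4(2) sub(3)] by blast
    have "card (meeting ?Fv N) \<le> card ?Fv" "card (meeting ?Av M) \<le> card ?Av"
      using finF finA by (auto intro!: card_mono simp: meeting_def)
    moreover have "card (meeting A N) + card ?Av \<le> card (meeting A S)"
      by (rule clique_cover_separate[OF covA v]) (auto simp: N_def)
    moreover have "card (meeting F M) + card ?Fv \<le> card (meeting F S)"
      by (rule clique_cover_separate[OF covF v]) (auto simp: M_def)
    ultimately show ?thesis using boundN boundM card_S by linarith
  qed
qed

section \<open>Maximal cliques and maximal anticliques\<close>

lemma max_anticliques_eq: "max_anticliques V E = max_cliques V (- E)"
  by (simp add: max_anticliques_def max_cliques_def indep_iff_clique_complement)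

lemma max_cliques_clique_cover:
  assumes fin: "finite V" and deg: "\<And>u. u \<in> V \<Longrightarrow> d \<le> clique_deg V E u"
  shows "clique_cover V E (max_cliques V E) d"
proof (rule clique_coverI)
  have fin_cliques: "finite {K. K \<subseteq> V \<and> clique K E}" using fin by simp
  show "\<exists>K\<in>max_cliques V E. C \<subseteq> K" if "C \<subseteq> V" "clique C E" for C
  proof -
    have "C \<in> {K. K \<subseteq> V \<and> clique K E}" using that by simp
    from finite_has_maximal2[OF fin_cliques this] obtain K
      where "K \<subseteq> V" "clique K E" "C \<subseteq> K"
        "\<And>K'. K' \<subseteq> V \<Longrightarrow> clique K' E \<Longrightarrow> K \<subseteq> K' \<Longrightarrow> K = K'"
      by auto
    then show ?thesis unfolding max_cliques_def by blast
  qed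
  show "clique (K \<inter> V) E" if "K \<in> max_cliques V E" for K
    using that by (simp add: max_cliques_def Int_absorb2)
  show "finite (max_cliques V E)"
    using fin by (simp add: max_cliques_def)
  show "d \<le> card {K \<in> max_cliques V E. u \<in> K}" if "u \<in> V" for u
    using deg[OF that] by (simp add: clique_deg_def)
qed

lemma clique_cover_min_clique_deg:
  assumes "finite V"
  shows "clique_cover V E (max_cliques V E) (min_clique_deg V E)"
  using assms by (intro max_cliques_clique_cover) (auto simp: min_clique_deg_def)

lemma min_clique_deg_pos:
  assumes "finite V" and "V \<noteq> {}"
  shows "1 \<le> min_clique_deg V E"
proof -
  have "1 \<le> clique_deg V E v" if "v \<in> V" for v
    using clique_cover_degree_pos[OF clique_cover_min_clique_deg[OF assms(1)] that]
    by (simp add: clique_deg_def)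
  then show ?thesis using assms by (simp add: min_clique_deg_def)
qed

lemma min_anticlique_deg_eq: "min_anticlique_deg V E = min_clique_deg V (- E)"
  by (simp add: min_anticlique_deg_def min_clique_deg_def anticlique_deg_def clique_deg_def
      max_anticliques_eq cong: image_cong_simp)

theorem theorem28:
  fixes V :: "'a set" and E :: "'a set set" and n :: nat
  assumes "finite V" and "V \<noteq> {}" and "E \<subseteq> [V]\<^bsup>2\<^esup>" and "card V = n"
  shows "int (num_max_cliques V E) + int (num_max_anticliques V E)
           \<ge> int n + int (min_clique_deg V E) + int (min_anticlique_deg V E) - 1
       \<and> int n + int (min_clique_deg V E) + int (min_anticlique_deg V E) - 1 \<ge> int n + 1"
proof -
  have "n + min_clique_deg V E + min_anticlique_deg V E
      \<le> card (meeting (max_cliques V E) V) + card (meeting (max_anticliques V E) V) + 1"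
    using cover_bound[OF assms(1,2) clique_cover_min_clique_deg clique_cover_min_clique_deg]
      assms by (simp add: min_anticlique_deg_eq max_anticliques_eq)
  moreover have "card (meeting (max_cliques V H) V) \<le> card (max_cliques V H)" for H
    using assms(1) by (intro card_mono) (auto simp: meeting_def max_cliques_def)
  ultimately have "n + min_clique_deg V E + min_anticlique_deg V E
      \<le> num_max_cliques V E + num_max_anticliques V E + 1"
    unfolding num_max_cliques_def num_max_anticliques_def max_anticliques_eq
    by (meson add_le_mono le_trans order_refl)
  moreover have "1 \<le> min_clique_deg V E" "1 \<le> min_anticlique_deg V E"
    using min_clique_deg_pos[OF assms(1,2)] by (simp_all add: min_anticlique_deg_eq)
  ultimately show ?thesis by linarith
qed

end
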